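(* Let $(\mathfrak g,\omega)$ be a three-step nilpotent symplectic Lie algebra of dimension less than or equal to eight. Then $(\mathfrak g,\omega)$ admits a Lagrangian ideal $\mathfrak a$ which contains $C^2\mathfrak g$.
   Context: All Lie algebras are finite-dimensional over a fixed field $k$ of characteristic $0$. A symplectic Lie algebra $(\mathfrak g,\omega)$ is a Lie algebra with a non-degenerate alternating form $\omega$ satisfying $\omega([u,v],w)+\omega([w,u],v)+\omega([v,w],u)=0$. With $C^0\mathfrak g=\mathfrak g$, $C^{i+1}\mathfrak g=[\mathfrak g,C^i\mathfrak g]$, three-step nilpotent means $C^3\mathfrak g=0$; in particular $C^2\mathfrak g=[\mathfrak g,[\mathfrak g,\mathfrak g]]$. A Lagrangian ideal is an ideal of $\mathfrak g$ equal to its $\omega$-orthogonal. *)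

theory Defs
  imports Complex_Main
begin

locale lie_algebra = vector_space scale
  for scale :: "'k::field_char_0 \<Rightarrow> 'g::ab_group_add \<Rightarrow> 'g" +
  fixes bracket :: "'g \<Rightarrow> 'g \<Rightarrow> 'g"
  assumes finite_dim: "\<exists>B. finite B \<and> span B = UNIV"
    and bracket_linear_right: "Vector_Spaces.linear scale scale (\<lambda>v. bracket u v)"
    and bracket_linear_left: "Vector_Spaces.linear scale scale (\<lambda>u. bracket u v)"
    and bracket_self: "bracket u u = 0"
    and jacobi: "bracket u (bracket v w) + bracket v (bracket w u) + bracket w (bracket u v) = 0"
begin

definition bracket_span :: "'g set \<Rightarrow> 'g set \<Rightarrow> 'g set" where
  "bracket_span A B = span {bracket u v | u v. u \<in> A \<and> v \<in> B}"

primrec lower_central :: "nat \<Rightarrow> 'g set" where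
  "lower_central 0 = UNIV"
| "lower_central (Suc i) = bracket_span UNIV (lower_central i)"

text \<open>Lie algebras of smaller nilpotency class, abelian ones included, are admitted.\<close>

definition three_step_nilpotent :: bool where
  "three_step_nilpotent \<longleftrightarrow> lower_central 3 = {0}"

definition lie_ideal :: "'g set \<Rightarrow> bool" where
  "lie_ideal I \<longleftrightarrow> subspace I \<and> (\<forall>u. \<forall>v\<in>I. bracket u v \<in> I)"

end

locale symplectic_lie_algebra = lie_algebra scale bracket
  for scale :: "'k::field_char_0 \<Rightarrow> 'g::ab_group_add \<Rightarrow> 'g"
    and bracket :: "'g \<Rightarrow> 'g \<Rightarrow> 'g" +
  fixes \<omega> :: "'g \<Rightarrow> 'g \<Rightarrow> 'k"
  assumes form_linear_right: "Vector_Spaces.linear scale (*) (\<lambda>v. \<omega> u v)"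
    and form_linear_left: "Vector_Spaces.linear scale (*) (\<lambda>u. \<omega> u v)"
    and form_alternating: "\<omega> u u = 0"
    and form_nondegenerate: "(\<forall>v. \<omega> u v = 0) \<Longrightarrow> u = 0"
    and form_closed: "\<omega> (bracket u v) w + \<omega> (bracket w u) v + \<omega> (bracket v w) u = 0"
begin

definition orthogonal :: "'g set \<Rightarrow> 'g set" where
  "orthogonal A = {v. \<forall>a\<in>A. \<omega> v a = 0}"

definition lagrangian_ideal :: "'g set \<Rightarrow> bool" where
  "lagrangian_ideal I \<longleftrightarrow> lie_ideal I \<and> orthogonal I = I"

end

end

(*
Write D = C^1 and Z = C^2 for the terms of the lower central series, x^ for the orthogonal of x,
and R = D \<inter> D^. Closedness of the form gives [Z^, Z^] \<subseteq> R, and g / Z^ has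
dimension dim Z \<le> dim R. Put dim D = dim R + 2s and dim D^ = dim R + 2t, so that
dim R + s + t \<le> 4. If s = 0 or t = 0, a Lagrangian subspace containing D, respectively D^, is an
ideal. If s \<ge> 2 and t > 0, then t = dim Z = 1, g = Z^ + <x>, and for w in D^ outside D every
Lagrangian subspace containing R, w, [x,w] lies in D + <w>, hence is an ideal. If s = 1 and t > 0,
then dim Z \<le> 2 and g = Z^ + <x,y>; one chooses e in D outside R orthogonal to [x, D^]: if
dim Z \<le> 1, take x = 0; if dim Z = 2, then Z = R and the Jacobi identity makes [x, D^] isotropic. For a maximal
isotropic ideal J containing R and e, the kernel of v \<mapsto> \<omega>([y,v],e) on J^ lies in J, and this
forces J^ = J since J^ / J, of dimension at most 1, carries a non-degenerate
alternating form.
*)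
theory Submission
  imports Defs
begin

section \<open>Linear algebra and the lower central series in a Lie algebra\<close>

definition (in lie_algebra) lie_basis :: "'g set" where
  "lie_basis = (SOME B. finite B \<and> independent B \<and> span B = UNIV)"

text \<open>Opens up dimension theory, whose locale takes a basis as parameter: a maximal
  independent subset of the finite spanning set from \<open>finite_dim\<close> provides one.\<close>

sublocale lie_algebra \<subseteq> finite_dimensional_vector_space scale lie_basis
proof -
  obtain A where A: "finite A" "span A = UNIV"
    using finite_dim by blast
  obtain B where B: "B \<subseteq> A" "independent B" "A \<subseteq> span B"
    using maximal_independent_subset[of A] by blast
  have "span B = UNIV"
    using A(2) B(3) span_minimal[OF B(3) subspace_span] by auto
  then have "\<exists>B. finite B \<and> independent B \<and> span B = UNIV"
    using B(2) finite_subset[OF B(1) A(1)] by (intro exI[of _ B]) simp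
  then have "finite lie_basis \<and> independent lie_basis \<and> span lie_basis = UNIV"
    unfolding lie_basis_def by (rule someI_ex)
  then show "finite_dimensional_vector_space scale lie_basis"
    by unfold_locales auto
qed

context lie_algebra
begin

lemma bracket_simps [simp]:
  "bracket (u + u') v = bracket u v + bracket u' v"
  "bracket u (v + v') = bracket u v + bracket u v'"
  "bracket (scale c u) v = scale c (bracket u v)"
  "bracket u (scale c v) = scale c (bracket u v)"
  using bracket_linear_left[of v] bracket_linear_right[of u]
  unfolding Vector_Spaces.linear_iff by blast+

lemma bracket_zero [simp]: "bracket 0 v = 0" "bracket u 0 = 0"
  using bracket_simps(3)[of 0 0 v] bracket_simps(4)[of u 0 0] by auto

lemma bracket_skew: "bracket v u = - bracket u v"
proof -
  have "bracket u v + bracket v u = bracket (u + v) (u + v)"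
    unfolding bracket_simps by (simp add: bracket_self)
  then have "bracket u v + bracket v u = 0" by (simp only: bracket_self)
  then show ?thesis by (metis minus_unique)
qed

lemma subspace_lower_central: "subspace (lower_central i)"
  by (cases i) (auto simp: bracket_span_def)

lemma bracket_in_lower_central:
  "v \<in> lower_central i \<Longrightarrow> bracket u v \<in> lower_central (Suc i)"
  by (auto simp: bracket_span_def intro!: span_base)

lemma lower_central_minimal:
  assumes "subspace S" and "\<And>u v. v \<in> lower_central i \<Longrightarrow> bracket u v \<in> S"
  shows "lower_central (Suc i) \<subseteq> S"
  unfolding lower_central.simps bracket_span_def
  by (rule span_minimal) (use assms in auto)

lemma lower_central_decreasing: "lower_central (Suc i) \<subseteq> lower_central i"
proof (induction i)
  case 0
  then show ?case by simp
next
  case (Suc i)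
  then show ?case
    by (intro lower_central_minimal subspace_lower_central)
       (blast intro: bracket_in_lower_central)
qed

lemma lie_ideal_span:
  assumes "\<And>u a. a \<in> A \<Longrightarrow> bracket u a \<in> span A"
  shows "lie_ideal (span A)"
  unfolding lie_ideal_def
proof (intro conjI allI ballI subspace_span)
  fix u v assume "v \<in> span A"
  then show "bracket u v \<in> span A"
    by (induction rule: span_induct_alt)
       (auto intro!: span_add span_scale assms span_zero)
qed

text \<open>Bounded dimension takes the place of Zorn's lemma. \<open>Q\<close> is left abstract
  because it serves both for isotropic subspaces and for isotropic ideals.\<close>

lemma maximal_subspace_exists:
  assumes "Q S" and "\<And>T. Q T \<Longrightarrow> subspace T"
  obtains M where "S \<subseteq> M" "Q M" "\<And>T. M \<subseteq> T \<Longrightarrow> Q T \<Longrightarrow> T = M"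
proof -
  have "\<exists>M. (S \<subseteq> M \<and> Q M) \<and> (\<forall>T. S \<subseteq> T \<and> Q T \<longrightarrow> dim T \<le> dim M)"
    by (rule ex_has_greatest_nat[where b = "Suc (card lie_basis)" and k = S])
       (use assms(1) dim_subset_UNIV in \<open>auto simp: dimension_def le_imp_less_Suc\<close>)
  then obtain M where M: "S \<subseteq> M" "Q M" "\<And>T. S \<subseteq> T \<Longrightarrow> Q T \<Longrightarrow> dim T \<le> dim M"
    by blast
  show thesis
  proof (rule that[OF M(1,2)])
    fix T assume T: "M \<subseteq> T" "Q T"
    then have "dim T \<le> dim M" using M by blast
    then show "T = M"
      using subspace_dim_equal[of M T] assms(2) M(2) T by blast
  qed
qed

text \<open>If \<open>f a\<close> is non-zero, subtracting a suitable multiple of \<open>a\<close>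
  moves any vector of \<open>A\<close> into the kernel, so the kernel and \<open>a\<close> together
  span \<open>A\<close>.\<close>

lemma dim_le_dim_kernel:
  assumes "subspace A" and f: "Vector_Spaces.linear scale (*) f"
  shows "dim A \<le> dim {a \<in> A. f a = 0} + 1"
proof (cases "\<forall>a\<in>A. f a = 0")
  case True
  then have "{a \<in> A. f a = 0} = A" by blast
  then show ?thesis by simp
next
  case False
  then obtain a where a: "a \<in> A" "f a \<noteq> 0" by blast
  have "A \<subseteq> span (insert a {a \<in> A. f a = 0})"
  proof
    fix x assume x: "x \<in> A"
    define k where "k = f x / f a"
    have "f (x - scale k a) = f x - k * f a"
      using f by (metis module_hom.diff module_hom.scale module_hom_iff_linear)
    then have "f (x - scale k a) = 0" by (simp add: k_def a)
    moreover have "x - scale k a \<in> A"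
      using assms(1) a x by (simp add: subspace_diff subspace_scale)
    ultimately have "x - scale k a \<in> span {a \<in> A. f a = 0}"
      by (intro span_base) blast
    then show "x \<in> span (insert a {a \<in> A. f a = 0})"
      unfolding span_breakdown_eq by blast
  qed
  then have "dim A \<le> dim (insert a {a \<in> A. f a = 0})" by (rule dim_mono)
  also have "\<dots> \<le> dim {a \<in> A. f a = 0} + 1" by (simp add: dim_insert)
  finally show ?thesis .
qed

lemma codim_one_complement:
  assumes "dim UNIV \<le> dim S + 1"
  obtains x where "span (insert x S) = UNIV"
proof (cases "span S = UNIV")
  case True
  then show thesis using that[of 0] by simp
next
  case False
  then obtain x where "x \<notin> span S" by blast
  then have "dim (insert x S) = dim S + 1" by (simp add: dim_insert)
  then have "dim (span (insert x S)) \<ge> dim UNIV" using assms by simp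
  then have "span (insert x S) = UNIV"
    by (intro subspace_dim_equal) auto
  then show thesis by (rule that)
qed

end

section \<open>Orthogonals, isotropic and Lagrangian subspaces\<close>

context symplectic_lie_algebra
begin

lemma form_simps [simp]:
  "\<omega> (u + u') v = \<omega> u v + \<omega> u' v"
  "\<omega> u (v + v') = \<omega> u v + \<omega> u v'"
  "\<omega> (scale c u) v = c * \<omega> u v"
  "\<omega> u (scale c v) = c * \<omega> u v"
  using form_linear_left[of v] form_linear_right[of u]
  unfolding Vector_Spaces.linear_iff by blast+

lemma form_zero [simp]: "\<omega> 0 v = 0" "\<omega> u 0 = 0"
  using form_simps(3)[of 0 0 v] form_simps(4)[of u 0 0] by auto

lemma form_skew: "\<omega> v u = - \<omega> u v"
proof -
  have "\<omega> u v + \<omega> v u = \<omega> (u + v) (u + v)"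
    unfolding form_simps by (simp add: form_alternating)
  then have "\<omega> u v + \<omega> v u = 0" by (simp only: form_alternating)
  then show ?thesis by (simp add: eq_neg_iff_add_eq_0 add.commute)
qed

lemma form_zero_sym: "\<omega> u v = 0 \<longleftrightarrow> \<omega> v u = 0"
  using form_skew[of u v] by auto

lemma form_diff: "\<omega> (u - u') v = \<omega> u v - \<omega> u' v"
  using form_simps(1)[of "u - u'" u' v] by (simp add: algebra_simps)

lemma subspace_orthogonal: "subspace (orthogonal A)"
  by (rule subspaceI) (auto simp: orthogonal_def)

lemma orthogonal_antimono: "A \<subseteq> B \<Longrightarrow> orthogonal B \<subseteq> orthogonal A"
  by (auto simp: orthogonal_def)

lemma subset_orthogonal_swap: "A \<subseteq> orthogonal B \<longleftrightarrow> B \<subseteq> orthogonal A"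
  using form_zero_sym by (auto simp: orthogonal_def)

lemma subset_orthogonal_orthogonal: "A \<subseteq> orthogonal (orthogonal A)"
  using subset_orthogonal_swap by blast

text \<open>The double orthogonal of \<open>A\<close> is a subspace containing \<open>A\<close>,
  hence contains \<open>span A\<close>; swapping the two sides gives the harder inclusion.\<close>

lemma orthogonal_span: "orthogonal (span A) = orthogonal A"
proof (rule antisym)
  show "orthogonal (span A) \<subseteq> orthogonal A"
    by (intro orthogonal_antimono span_superset)
  have "span A \<subseteq> orthogonal (orthogonal A)"
    by (intro span_minimal subspace_orthogonal subset_orthogonal_orthogonal)
  then show "orthogonal A \<subseteq> orthogonal (span A)"
    using subset_orthogonal_swap by blast
qed

lemma orthogonal_Un: "orthogonal (A \<union> B) = orthogonal A \<inter> orthogonal B"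
  by (auto simp: orthogonal_def)

lemma orthogonal_insert: "orthogonal (insert v A) = {u \<in> orthogonal A. \<omega> u v = 0}"
  by (auto simp: orthogonal_def)

text \<open>Each vector of \<open>C\<close> imposes one linear condition on
  \<open>A\<close>.\<close>

lemma dim_le_dim_Int_orthogonal:
  assumes "subspace A" "finite C"
  shows "dim A \<le> dim (A \<inter> orthogonal C) + card C"
  using assms(2)
proof (induction C rule: finite_induct)
  case empty
  then show ?case by (simp add: orthogonal_def)
next
  case (insert c C)
  have "dim (A \<inter> orthogonal C) \<le> dim {a \<in> A \<inter> orthogonal C. \<omega> a c = 0} + 1"
    by (intro dim_le_dim_kernel subspace_inter assms(1) subspace_orthogonal form_linear_left)
  also have "{a \<in> A \<inter> orthogonal C. \<omega> a c = 0} = A \<inter> orthogonal (insert c C)"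
    by (auto simp: orthogonal_insert)
  finally show ?case using insert by simp
qed

text \<open>Conditions are counted twice. A basis of \<open>S\<close> cuts the whole space down to
  \<open>orthogonal S\<close>; the vectors that extend it to a basis of the whole space cut
  \<open>orthogonal S\<close> down to zero, by non-degeneracy.\<close>

lemma dim_orthogonal:
  assumes "subspace S"
  shows "dim S + dim (orthogonal S) = dim UNIV"
proof -
  obtain B where B: "B \<subseteq> S" "independent B" "S \<subseteq> span B" "card B = dim S"
    using basis_exists[of S] by blast
  have S: "span B = S" using B(1,3) assms by (metis span_subspace)
  define B' where "B' = extend_basis B"
  have B': "B \<subseteq> B'" "independent B'" "span B' = UNIV"
    unfolding B'_def using extend_basis_superset[OF B(2)] independent_extend_basis[OF B(2)]
      span_extend_basis[OF B(2)] by auto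
  have fin: "finite B'" using B'(2) by (rule finiteI_independent)
  have card: "card (B' - B) + dim S = dim UNIV"
  proof -
    have "card B' = dim UNIV"
      using B' by (metis dim_eq_card_independent dim_span)
    then show ?thesis
      using B(4) B'(1) fin by (metis card_Diff_subset card_mono finite_subset le_add_diff_inverse2)
  qed
  have "dim UNIV \<le> dim (UNIV \<inter> orthogonal B) + card B"
    by (rule dim_le_dim_Int_orthogonal) (use fin B'(1) finite_subset in auto)
  then have "dim UNIV \<le> dim (orthogonal S) + dim S"
    using orthogonal_span[of B] B(4) S by simp
  moreover have "dim (orthogonal S) \<le> dim (orthogonal S \<inter> orthogonal (B' - B)) + card (B' - B)"
    by (rule dim_le_dim_Int_orthogonal) (use fin subspace_orthogonal in auto)
  moreover have "orthogonal S \<inter> orthogonal (B' - B) = orthogonal (span B')"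
    using B'(1) orthogonal_span orthogonal_Un[of B "B' - B"] S by (metis Un_Diff_cancel sup.absorb2)
  moreover have "orthogonal (span B') = {0}"
    using form_nondegenerate by (auto simp: orthogonal_def B'(3))
  ultimately show ?thesis using card by simp
qed

lemma orthogonal_orthogonal:
  assumes "subspace S"
  shows "orthogonal (orthogonal S) = S"
proof -
  have "dim S = dim (orthogonal (orthogonal S))"
    using dim_orthogonal[OF assms] dim_orthogonal[OF subspace_orthogonal[of S]] by simp
  moreover note subset_orthogonal_orthogonal[of S]
  ultimately show ?thesis
    by (intro subspace_dim_equal[OF assms subspace_orthogonal, symmetric]) auto
qed

text \<open>Both sides have the same orthogonal. For \<open>S = C1\<close> this splits a vector of
  \<open>orthogonal R\<close> into a part in \<open>C1\<close> and a part in
  \<open>orthogonal C1\<close>.\<close>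

lemma orthogonal_Int_orthogonal:
  assumes "subspace S"
  shows "orthogonal (S \<inter> orthogonal S) = span (S \<union> orthogonal S)"
proof -
  have "orthogonal (span (S \<union> orthogonal S)) = S \<inter> orthogonal S"
    by (simp add: orthogonal_span orthogonal_Un orthogonal_orthogonal[OF assms] inf_commute)
  then show ?thesis
    using orthogonal_orthogonal[OF subspace_span, of "S \<union> orthogonal S"] by simp
qed

definition isotropic :: "'g set \<Rightarrow> bool" where
  "isotropic S \<longleftrightarrow> S \<subseteq> orthogonal S"

lemma isotropic_span: "isotropic A \<Longrightarrow> isotropic (span A)"
  unfolding isotropic_def orthogonal_span
  by (intro span_minimal subspace_orthogonal)

lemma isotropic_insert: "isotropic S \<Longrightarrow> v \<in> orthogonal S \<Longrightarrow> isotropic (insert v S)"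
  using form_zero_sym[of _ v] form_alternating[of v]
  unfolding isotropic_def orthogonal_def by blast

lemma isotropic_Int_orthogonal: "isotropic (S \<inter> orthogonal S)"
  by (auto simp: isotropic_def orthogonal_def)

text \<open>A vector of \<open>A\<close> orthogonal to a maximal isotropic \<open>L\<close> could be
  adjoined to \<open>L\<close>. The form may be degenerate on \<open>A\<close>, as it is when parity
  is studied below.\<close>

lemma maximal_isotropic_in:
  assumes "isotropic S" "subspace S" "S \<subseteq> A" "subspace A"
  obtains L where "S \<subseteq> L" "L \<subseteq> A" "subspace L" "A \<inter> orthogonal L = L"
proof -
  obtain L where L: "S \<subseteq> L" "subspace L \<and> isotropic L \<and> L \<subseteq> A"
    and max: "\<And>T. L \<subseteq> T \<Longrightarrow> subspace T \<and> isotropic T \<and> T \<subseteq> A \<Longrightarrow> T = L"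
    using maximal_subspace_exists[of "\<lambda>L. subspace L \<and> isotropic L \<and> L \<subseteq> A" S] assms
    by metis
  have "A \<inter> orthogonal L \<subseteq> L"
  proof
    fix v assume v: "v \<in> A \<inter> orthogonal L"
    then have "isotropic (span (insert v L))"
      using L by (intro isotropic_span isotropic_insert) auto
    moreover have "span (insert v L) \<subseteq> A"
      using v L by (intro span_minimal assms(4)) auto
    ultimately have "span (insert v L) = L"
      using L span_superset[of "insert v L"] by (intro max) auto
    then show "v \<in> L" using span_base[of v "insert v L"] by auto
  qed
  then have "A \<inter> orthogonal L = L"
    using L by (auto simp: isotropic_def)
  then show thesis
    using that L by blast
qed

lemma maximal_isotropic:
  assumes "isotropic S"
  obtains L where "S \<subseteq> L" "subspace L" "orthogonal L = L"
proof -
  obtain L where "span S \<subseteq> L" "subspace L" "UNIV \<inter> orthogonal L = L"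
    by (rule maximal_isotropic_in[OF isotropic_span[OF assms] subspace_span subset_UNIV subspace_UNIV])
  then show thesis using that[of L] span_superset[of S] by auto
qed

text \<open>The quotient of \<open>S\<close> by its radical is symplectic, hence even-dimensional;
  \<open>s\<close> is the dimension that a maximal isotropic subspace of \<open>S\<close> has modulo
  the radical.\<close>

lemma even_dim_mod_radical:
  assumes "subspace S"
  obtains s where "dim S = dim (S \<inter> orthogonal S) + 2 * s"
proof -
  let ?R = "S \<inter> orthogonal S"
  have R: "subspace ?R" by (intro subspace_inter assms subspace_orthogonal)
  obtain L where L: "?R \<subseteq> L" "L \<subseteq> S" "subspace L" "S \<inter> orthogonal L = L"
    by (rule maximal_isotropic_in[OF isotropic_Int_orthogonal R _ assms]) auto
  \<comment> \<open>This is the dual of \<open>S \<inter> orthogonal L = L\<close>; comparing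
    dimensions yields \<open>dim S + dim ?R = 2 * dim L\<close>.\<close>
  have "orthogonal L = span (orthogonal S \<union> L)"
  proof -
    have "orthogonal (span (orthogonal S \<union> L)) = L"
      by (simp add: orthogonal_span orthogonal_Un orthogonal_orthogonal[OF assms] L(4))
    then show ?thesis using orthogonal_orthogonal[OF subspace_span] by metis
  qed
  moreover have "dim (span (orthogonal S \<union> L)) + dim (orthogonal S \<inter> L)
      = dim (orthogonal S) + dim L"
    using dim_sums_Int[OF subspace_orthogonal[of S] L(3)]
    by (simp only: span_Un) (simp add: span_eq_iff[THEN iffD2] subspace_orthogonal L(3))
  moreover have "orthogonal S \<inter> L = ?R" using L by blast
  moreover note dim_orthogonal[OF L(3)] dim_orthogonal[OF assms]
  moreover have "dim ?R \<le> dim L" using L by (intro dim_subset)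
  \<comment> \<open>The subtraction of naturals is exact because
    \<open>dim ?R \<le> dim L\<close>.\<close>
  ultimately have "dim S = dim ?R + 2 * (dim L - dim ?R)"
    by simp
  then show thesis by (rule that)
qed

text \<open>Modulo its radical, \<open>S\<close> is a symplectic plane, in which the orthogonal of a
  non-zero vector is the line through it.\<close>

lemma orthogonal_vector_in_hyperplane:
  assumes "subspace S" and dimS: "dim S = dim (S \<inter> orthogonal S) + 2"
    and e: "e \<in> S" "e \<notin> orthogonal S"
  shows "{a \<in> S. \<omega> a e = 0} \<subseteq> span (insert e (S \<inter> orthogonal S))"
proof -
  let ?R = "S \<inter> orthogonal S" and ?H = "{a \<in> S. \<omega> a e = 0}"
  have R: "subspace ?R" by (intro subspace_inter assms subspace_orthogonal)
  have H: "subspace ?H"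
    using assms(1) by (auto intro!: subspaceI simp: subspace_0 subspace_add subspace_scale)
  have "?H \<noteq> S" using e form_zero_sym by (auto simp: orthogonal_def)
  then have "dim ?H < dim S"
    using subspace_dim_equal[OF H assms(1)] by force
  moreover have "e \<notin> span ?R"
    unfolding span_eq_iff[THEN iffD2, OF R] using e by blast
  then have "dim (span (insert e ?R)) = dim ?R + 1"
    by (simp add: dim_insert)
  moreover have "span (insert e ?R) \<subseteq> ?H"
    using e by (intro span_minimal H)
      (auto simp: form_alternating orthogonal_def)
  ultimately have "span (insert e ?R) = ?H"
    using dimS by (intro subspace_dim_equal H subspace_span) auto
  then show ?thesis by simp
qed

text \<open>The kernel condition makes \<open>orthogonal J\<close> at most one-dimensional modulo
  \<open>J\<close>. An alternating form on such a quotient vanishes, so \<open>orthogonal J\<close>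
  lies in its own orthogonal, which is \<open>J\<close>.\<close>

lemma orthogonal_subset_if_kernel_subset:
  assumes "subspace J" and J: "isotropic J"
    and f: "Vector_Spaces.linear scale (*) f"
    and ker: "\<And>v. v \<in> orthogonal J \<Longrightarrow> f v = 0 \<Longrightarrow> v \<in> J"
  shows "orthogonal J = J"
proof (rule antisym)
  show "orthogonal J \<subseteq> J"
  proof
    fix v assume v: "v \<in> orthogonal J"
    have "v \<in> orthogonal (orthogonal J)" if "f v \<noteq> 0"
      unfolding orthogonal_def[of "orthogonal J"]
    proof (intro CollectI ballI)
      fix u assume u: "u \<in> orthogonal J"
      define k where "k = f u / f v"
      have "f (u - scale k v) = f u - k * f v"
        using f by (metis module_hom.diff module_hom.scale module_hom_iff_linear)
      then have "f (u - scale k v) = 0" by (simp add: k_def that)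
      moreover have "u - scale k v \<in> orthogonal J"
        by (intro subspace_diff subspace_scale subspace_orthogonal u v)
      ultimately have "u - scale k v \<in> J" by (intro ker)
      then have "\<omega> v (u - scale k v) = 0" using v by (simp add: orthogonal_def)
      then have "\<omega> (u - scale k v) v = 0" by (simp add: form_zero_sym)
      then have "\<omega> u v = 0" by (simp add: form_diff form_alternating)
      then show "\<omega> v u = 0" by (simp add: form_zero_sym)
    qed
    then show "v \<in> J"
      using ker[OF v] orthogonal_orthogonal[OF assms(1)] by blast
  qed
  show "J \<subseteq> orthogonal J" using J by (simp add: isotropic_def)
qed

end

section \<open>Lagrangian ideals in three-step nilpotent symplectic Lie algebras\<close>

locale three_step_symplectic_lie_algebra = symplectic_lie_algebra scale bracket \<omega>
  for scale :: "'k::field_char_0 \<Rightarrow> 'g::ab_group_add \<Rightarrow> 'g"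
    and bracket :: "'g \<Rightarrow> 'g \<Rightarrow> 'g"
    and \<omega> :: "'g \<Rightarrow> 'g \<Rightarrow> 'k" +
  assumes three_step: three_step_nilpotent
begin

declare lower_central.simps(2) [simp del]

abbreviation C1 :: "'g set" where "C1 \<equiv> lower_central (Suc 0)"
abbreviation C2 :: "'g set" where "C2 \<equiv> lower_central (Suc (Suc 0))"
abbreviation R :: "'g set" where "R \<equiv> C1 \<inter> orthogonal C1"

lemma bracket_in_C1: "bracket u v \<in> C1"
  by (rule bracket_in_lower_central) simp

lemma bracket_in_C2: "v \<in> C1 \<Longrightarrow> bracket u v \<in> C2" "v \<in> C1 \<Longrightarrow> bracket v u \<in> C2"
  using bracket_in_lower_central[of v "Suc 0"] bracket_skew[of v u]
    subspace_neg[OF subspace_lower_central] by auto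

lemma C2_central: "v \<in> C2 \<Longrightarrow> bracket u v = 0" "v \<in> C2 \<Longrightarrow> bracket v u = 0"
proof -
  have "lower_central (Suc (Suc (Suc 0))) = {0}"
    using three_step by (simp add: three_step_nilpotent_def numeral_3_eq_3)
  then show "bracket u v = 0" if "v \<in> C2"
    using bracket_in_lower_central[OF that, of u] by blast
  then show "bracket v u = 0" if "v \<in> C2"
    using that bracket_skew[of v u] by simp
qed

lemma C2_subset_C1: "C2 \<subseteq> C1"
  by (rule lower_central_decreasing)

text \<open>When the third argument is central, two of the three terms of \<open>form_closed\<close>
  vanish.\<close>

lemma C1_subset_orthogonal_C2: "C1 \<subseteq> orthogonal C2"
proof (rule lower_central_minimal[OF subspace_orthogonal])
  fix u v
  have "\<omega> (bracket u v) z = 0" if "z \<in> C2" for z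
    using form_closed[of u v z] C2_central[OF that] by simp
  then show "bracket u v \<in> orthogonal C2" by (simp add: orthogonal_def)
qed

lemma C2_subset_R: "C2 \<subseteq> R"
  using C2_subset_C1 C1_subset_orthogonal_C2 subset_orthogonal_swap by blast

lemma subspace_R: "subspace R"
  by (intro subspace_inter subspace_lower_central subspace_orthogonal)

text \<open>Against a vector of \<open>C1\<close>, the other two terms of \<open>form_closed\<close>
  pair \<open>u\<close> and \<open>v\<close> with elements of \<open>C2\<close>.\<close>

lemma bracket_in_R:
  assumes "u \<in> orthogonal C2" "v \<in> orthogonal C2"
  shows "bracket u v \<in> R"
proof -
  have "\<omega> (bracket u v) a = 0" if "a \<in> C1" for a
  proof -
    have "\<omega> u (bracket v a) = 0" "\<omega> v (bracket a u) = 0"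
      using assms bracket_in_C2[OF that] by (auto simp: orthogonal_def)
    then show ?thesis
      using form_closed[of u v a] form_skew[of u "bracket v a"] form_skew[of v "bracket a u"]
      by simp
  qed
  then show ?thesis by (simp add: orthogonal_def bracket_in_C1)
qed

text \<open>Any subspace containing \<open>C1\<close> is an ideal.\<close>

lemma lagrangian_if_isotropic_C1:
  assumes "C1 \<subseteq> orthogonal C1"
  shows "\<exists>L. lagrangian_ideal L \<and> C2 \<subseteq> L"
proof -
  obtain L where L: "C1 \<subseteq> L" "subspace L" "orthogonal L = L"
    using maximal_isotropic[of C1] assms unfolding isotropic_def by blast
  then have "lie_ideal L"
    using bracket_in_C1 by (auto simp: lie_ideal_def)
  then show ?thesis
    using L C2_subset_C1 by (auto simp: lagrangian_ideal_def)
qed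

text \<open>A Lagrangian \<open>L\<close> above \<open>orthogonal C1\<close> lies inside
  \<open>C1\<close>, so its brackets fall into \<open>C2\<close>, which is contained in
  \<open>R\<close> and hence in \<open>L\<close>.\<close>

lemma lagrangian_if_coisotropic_C1:
  assumes "orthogonal C1 \<subseteq> C1"
  shows "\<exists>L. lagrangian_ideal L \<and> C2 \<subseteq> L"
proof -
  have dd: "orthogonal (orthogonal C1) = C1"
    by (rule orthogonal_orthogonal[OF subspace_lower_central])
  obtain L where L: "orthogonal C1 \<subseteq> L" "subspace L" "orthogonal L = L"
    using maximal_isotropic[of "orthogonal C1"] assms dd unfolding isotropic_def by blast
  have "L \<subseteq> C1" using orthogonal_antimono[OF L(1)] L(3) dd by simp
  then have "bracket u v \<in> L" if "v \<in> L" for u v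
    using that bracket_in_C2(1)[of v u] C2_subset_R L(1) by blast
  then have "lie_ideal L" using L(2) by (simp add: lie_ideal_def)
  moreover have "C2 \<subseteq> L" using C2_subset_R L(1) by blast
  ultimately show ?thesis
    using L(3) unfolding lagrangian_ideal_def by blast
qed

text \<open>\<open>L\<close> is trapped inside the span of \<open>w\<close> and \<open>C1\<close>.
  Brackets with \<open>C1\<close> land in \<open>C2\<close>, so only the brackets with
  \<open>w\<close> need control, and \<open>L\<close> is built to contain
  \<open>bracket x w\<close>.\<close>

lemma lagrangian_if_small_orthogonal_C1:
  assumes w: "w \<in> orthogonal C1" "w \<notin> C1"
    and dim: "dim (orthogonal C1) = dim R + 2"
    and x: "span (insert x (orthogonal C2)) = UNIV"
  shows "\<exists>L. lagrangian_ideal L \<and> C2 \<subseteq> L"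
proof -
  have dd: "orthogonal (orthogonal C1) = C1"
    by (rule orthogonal_orthogonal[OF subspace_lower_central])
  have wC2: "w \<in> orthogonal C2"
    using w orthogonal_antimono[OF C2_subset_C1] by blast
  have "isotropic (insert w (insert (bracket x w) R))"
  proof (intro isotropic_insert isotropic_Int_orthogonal)
    show "bracket x w \<in> orthogonal R"
      using bracket_in_C1 form_zero_sym by (auto simp: orthogonal_def)
    show "w \<in> orthogonal (insert (bracket x w) R)"
      using w bracket_in_C1 by (auto simp: orthogonal_def)
  qed
  then obtain L where L: "insert w (insert (bracket x w) R) \<subseteq> L" "subspace L" "orthogonal L = L"
    by (rule maximal_isotropic)
  \<comment> \<open>The plane argument applied to \<open>orthogonal C1\<close>, whose radical is
    also \<open>R\<close>; taking orthogonals then bounds \<open>L\<close> from above.\<close>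
  have "orthogonal (insert w C1) \<subseteq> span (insert w R)"
    using orthogonal_vector_in_hyperplane[OF subspace_orthogonal[of C1] _ w(1)] w dim
    by (simp add: orthogonal_insert dd inf_commute)
  also have "\<dots> \<subseteq> L"
    using L by (intro span_minimal) auto
  finally have "orthogonal L \<subseteq> orthogonal (orthogonal (insert w C1))"
    by (rule orthogonal_antimono)
  then have LsubC: "L \<subseteq> span (insert w C1)"
    using L(3) orthogonal_orthogonal[OF subspace_span, of "insert w C1"]
    by (simp add: orthogonal_span)
  have bw: "bracket u w \<in> L" for u
  proof -
    obtain k where "u - scale k x \<in> span (orthogonal C2)"
      using x span_breakdown_eq by blast
    then have "bracket (u - scale k x) w \<in> R"
      using wC2 by (intro bracket_in_R) (simp_all add: span_eq_iff[THEN iffD2] subspace_orthogonal)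
    then have "bracket (u - scale k x) w + scale k (bracket x w) \<in> L"
      using L by (intro subspace_add subspace_scale) auto
    then show ?thesis using bracket_simps(1)[of "u - scale k x" "scale k x" w] by simp
  qed
  have "bracket u v \<in> L" if v: "v \<in> L" for u v
  proof -
    obtain k where "v - scale k w \<in> span C1"
      using v LsubC span_breakdown_eq by blast
    then have "bracket u (v - scale k w) \<in> C2"
      by (intro bracket_in_C2) (simp add: span_eq_iff[THEN iffD2] subspace_lower_central)
    then have "bracket u (v - scale k w) + scale k (bracket u w) \<in> L"
      using L bw C2_subset_R by (intro subspace_add subspace_scale) auto
    then show ?thesis using bracket_simps(2)[of u "v - scale k w" "scale k w"] by simp
  qed
  moreover have "C2 \<subseteq> L" using C2_subset_R L(1) by blast
  ultimately show ?thesis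
    using L(2,3) unfolding lagrangian_ideal_def lie_ideal_def by blast
qed

text \<open>In the plane \<open>C1\<close> modulo \<open>R\<close>, a commutator orthogonal to
  \<open>e\<close> lies in the span of \<open>e\<close> and \<open>R\<close>. Being an ideal thus
  reduces to the brackets with \<open>x\<close>, controlled by the choice of \<open>e\<close>, and
  with \<open>y\<close>, controlled by one functional.\<close>

lemma lagrangian_if_small_C1:
  assumes e: "e \<in> C1" "e \<notin> orthogonal C1"
    and dim: "dim C1 = dim R + 2"
    and x: "span (insert x (insert y (orthogonal C2))) = UNIV"
    and ex: "\<And>w. w \<in> orthogonal C1 \<Longrightarrow> \<omega> (bracket x w) e = 0"
  shows "\<exists>L. lagrangian_ideal L \<and> C2 \<subseteq> L"
proof -
  let ?J = "span (insert e R)"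
  have e_perp: "a \<in> ?J" if "a \<in> C1" "\<omega> a e = 0" for a
    using orthogonal_vector_in_hyperplane[OF subspace_lower_central dim e] that by blast
  have "e \<in> orthogonal R" using e form_zero_sym by (auto simp: orthogonal_def)
  then have "isotropic ?J"
    by (intro isotropic_span isotropic_insert isotropic_Int_orthogonal)
  \<comment> \<open>Here \<open>?J\<close> lies in \<open>C1\<close>, so all brackets with it fall
    into \<open>C2\<close>, inside \<open>R\<close>.\<close>
  moreover have "lie_ideal ?J"
    using bracket_in_C2 C2_subset_R e by (intro lie_ideal_span span_base) blast
  ultimately obtain J where J: "?J \<subseteq> J" "isotropic J \<and> lie_ideal J"
    and max: "\<And>T. J \<subseteq> T \<Longrightarrow> isotropic T \<and> lie_ideal T \<Longrightarrow> T = J"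
    using maximal_subspace_exists[of "\<lambda>T. isotropic T \<and> lie_ideal T" ?J]
    unfolding lie_ideal_def by metis
  have subJ: "subspace J" using J by (simp add: lie_ideal_def)
  have RJ: "R \<subseteq> J" using J(1) span_superset[of "insert e R"] by blast
  \<comment> \<open>Such a \<open>v\<close> can be adjoined to \<open>J\<close> keeping it an
    isotropic ideal, so maximality puts \<open>v\<close> into \<open>J\<close>.\<close>
  have step: "v \<in> J" if v: "v \<in> orthogonal J" and yv: "\<omega> (bracket y v) e = 0" for v
  proof -
    have vC2: "v \<in> orthogonal C2"
      using v orthogonal_antimono[of C2 J] RJ C2_subset_R by blast
    have "v \<in> span (C1 \<union> orthogonal C1)"
      using v orthogonal_antimono[OF RJ] orthogonal_Int_orthogonal[OF subspace_lower_central] by blast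
    then obtain a w where aw: "v = a + w" "a \<in> C1" "w \<in> orthogonal C1"
      unfolding span_Un
      by (auto simp: span_eq_iff[THEN iffD2] subspace_orthogonal subspace_lower_central)
    have "bracket x a \<in> J" using aw bracket_in_C2 C2_subset_R RJ by blast
    moreover have "bracket x w \<in> J" using ex[OF aw(3)] e_perp bracket_in_C1 J(1) by blast
    ultimately have bx: "bracket x v \<in> J" using subJ aw by (simp add: subspace_add)
    have by': "bracket y v \<in> J" using yv e_perp bracket_in_C1 J(1) by blast
    \<comment> \<open>Modulo \<open>x\<close> and \<open>y\<close>, \<open>u\<close> lies in
      \<open>orthogonal C2\<close>, as \<open>v\<close> does, so that part of the bracket falls into
      \<open>R\<close>.\<close>
    have "bracket u v \<in> J" for u
    proof -
      obtain k where "u - scale k x \<in> span (insert y (orthogonal C2))"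
        using x span_breakdown_eq by blast
      then obtain l where "u - scale k x - scale l y \<in> span (orthogonal C2)"
        using span_breakdown_eq by blast
      then have "bracket (u - scale k x - scale l y) v \<in> R"
        using vC2 by (intro bracket_in_R) (simp_all add: span_eq_iff[THEN iffD2] subspace_orthogonal)
      then have "bracket (u - scale k x - scale l y) v + scale l (bracket y v) + scale k (bracket x v) \<in> J"
        using RJ bx by' subJ by (intro subspace_add subspace_scale) auto
      moreover have "u = (u - scale k x - scale l y) + scale l y + scale k x" by simp
      ultimately show ?thesis by (metis bracket_simps(1,3))
    qed
    then have "lie_ideal (span (insert v J))"
      using J by (intro lie_ideal_span span_base) (auto simp: lie_ideal_def)
    moreover have "isotropic (span (insert v J))"
      using J v by (intro isotropic_span isotropic_insert) auto
    ultimately have "span (insert v J) = J"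
      using span_superset[of "insert v J"] by (intro max) auto
    then show ?thesis using span_base[of v "insert v J"] by auto
  qed
  have lin: "Vector_Spaces.linear scale (*) (\<lambda>v. \<omega> (bracket y v) e)"
    using form_linear_left[of e] unfolding Vector_Spaces.linear_iff by simp
  have "orthogonal J = J"
    using J by (intro orthogonal_subset_if_kernel_subset[OF subJ _ lin step]) auto
  moreover have "C2 \<subseteq> J" using C2_subset_R RJ by (rule order_trans)
  ultimately show ?thesis
    using J by (auto simp: lagrangian_ideal_def)
qed

text \<open>Either the brackets of \<open>x\<close> with \<open>orthogonal C1\<close> are orthogonal
  to all of \<open>C1\<close>, or one of them serves as \<open>e\<close>, because these brackets are
  mutually orthogonal.\<close>

lemma bracket_adapted_vector_exists:
  assumes RC2: "R = C2" and nonisotropic: "\<not> C1 \<subseteq> orthogonal C1"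
  obtains e where "e \<in> C1" "e \<notin> orthogonal C1"
    "\<And>w. w \<in> orthogonal C1 \<Longrightarrow> \<omega> (bracket x w) e = 0"
proof (cases "\<exists>w\<in>orthogonal C1. bracket x w \<notin> orthogonal C1")
  case False
  then have "\<omega> (bracket x w) e = 0" if "w \<in> orthogonal C1" "e \<in> C1" for w e
    using that by (auto simp: orthogonal_def)
  then show thesis using that nonisotropic by blast
next
  case True
  then obtain w0 where w0: "w0 \<in> orthogonal C1" "bracket x w0 \<notin> orthogonal C1" by blast
  \<comment> \<open>The middle term of \<open>form_closed\<close> drops out because \<open>w\<close>
    is orthogonal to commutators.\<close>
  have form: "\<omega> (bracket x w) (bracket x w') = - \<omega> (bracket w (bracket x w')) x"
    if "w \<in> orthogonal C1" "w' \<in> orthogonal C1" for w w'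
  proof -
    have "\<omega> w (bracket (bracket x w') x) = 0"
      using that bracket_in_C1 by (auto simp: orthogonal_def)
    then have "\<omega> (bracket (bracket x w') x) w = 0" by (simp add: form_zero_sym)
    then show ?thesis
      using form_closed[of x w "bracket x w'"] by (simp add: eq_neg_iff_add_eq_0)
  qed
  have "\<omega> (bracket x w) (bracket x w0) = 0" if w: "w \<in> orthogonal C1" for w
  proof -
    have "orthogonal C1 \<subseteq> orthogonal C2" by (rule orthogonal_antimono[OF C2_subset_C1])
    \<comment> \<open>Since \<open>R = C2\<close>, this commutator is central, and the Jacobi
      identity makes \<open>bracket w (bracket x w0)\<close> symmetric in \<open>w\<close> and
      \<open>w0\<close>.\<close>
    then have "bracket w0 w \<in> C2"
      using bracket_in_R[of w0 w] w w0 RC2 by blast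
    then have "bracket x (bracket w0 w) = 0" by (rule C2_central)
    then have "bracket w (bracket x w0) + bracket w0 (bracket w x) = 0"
      using jacobi[of w x w0] by (simp add: add.commute)
    then have "bracket w (bracket x w0) = bracket w0 (bracket x w)"
      using bracket_skew[of w x] bracket_simps(4)[of w0 "-1" "bracket x w"]
      by simp
    then have "\<omega> (bracket x w) (bracket x w0) = \<omega> (bracket x w0) (bracket x w)"
      using form[OF w w0(1)] form[OF w0(1) w] by simp
    \<comment> \<open>The value is both symmetric and skew in \<open>w\<close> and
      \<open>w0\<close>, hence zero in characteristic 0.\<close>
    then show ?thesis
      using form_skew[of "bracket x w" "bracket x w0"] by simp
  qed
  then show thesis using that w0 bracket_in_C1 by blast
qed

section \<open>Dimension count and case distinction\<close>

theorem lagrangian_ideal_exists: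
  assumes "dim (UNIV :: 'g set) \<le> 8"
  shows "\<exists>L. lagrangian_ideal L \<and> C2 \<subseteq> L"
proof (cases "C1 \<subseteq> orthogonal C1 \<or> orthogonal C1 \<subseteq> C1")
  case True
  then show ?thesis
    using lagrangian_if_isotropic_C1 lagrangian_if_coisotropic_C1 by blast
next
  case False
  have dd: "orthogonal (orthogonal C1) = C1"
    by (rule orthogonal_orthogonal[OF subspace_lower_central])
  obtain s where s: "dim C1 = dim R + 2 * s"
    by (rule even_dim_mod_radical[OF subspace_lower_central])
  obtain t where t: "dim (orthogonal C1) = dim R + 2 * t"
    using even_dim_mod_radical[OF subspace_orthogonal, of C1] dd by (metis inf_commute)
  have n: "dim R + s + t \<le> 4"
    using dim_orthogonal[OF subspace_lower_central[of "Suc 0"]] s t assms by simp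
  have "s \<noteq> 0"
    using subspace_dim_equal[OF subspace_R subspace_lower_central[of "Suc 0"]] s False by auto
  have "t \<noteq> 0"
    using subspace_dim_equal[OF subspace_R subspace_orthogonal[of C1]] t False by auto
  \<comment> \<open>If \<open>R\<close> were zero, \<open>C2\<close> would vanish and
    \<open>C1\<close> would be central; closedness would then make \<open>C1\<close> isotropic, a
    case already settled.\<close>
  have "R \<noteq> {0}"
  proof
    assume "R = {0}"
    then have "C2 \<subseteq> {0}" using C2_subset_R by simp
    then have "bracket u v = 0" "bracket v u = 0" if "v \<in> C1" for u v
      using bracket_in_C2[OF that] by blast+
    then have "\<omega> (bracket u v) z = 0" if "z \<in> C1" for u v z
      using form_closed[of u v z] that by simp
    then have "C1 \<subseteq> orthogonal C1"
      by (intro lower_central_minimal subspace_orthogonal) (auto simp: orthogonal_def)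
    with False show False by blast
  qed
  then have r: "dim R \<noteq> 0"
    using subspace_0[OF subspace_R] by (auto simp del: Int_iff)
  have c: "dim C2 \<le> dim R" using C2_subset_R by (rule dim_subset)
  have codim: "dim UNIV = dim (orthogonal C2) + dim C2"
    using dim_orthogonal[OF subspace_lower_central[of "Suc (Suc 0)"]] by simp
  show ?thesis
  proof (cases "dim C2 \<le> 1")
    case True
    then obtain x where x: "span (insert x (orthogonal C2)) = UNIV"
      using codim codim_one_complement[of "orthogonal C2"] by auto
    show ?thesis
    proof (cases "s = 1")
      case True
      obtain e where e: "e \<in> C1" "e \<notin> orthogonal C1" using False by blast
      \<comment> \<open>With the zero vector in the role of \<open>x\<close>, the condition on
        \<open>e\<close> is trivial, and the actual complement takes the role of
        \<open>y\<close>.\<close>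
      have "span (insert 0 (insert x (orthogonal C2))) = UNIV"
        using x by simp
      then show ?thesis
        using True s by (intro lagrangian_if_small_C1[OF e, of 0 x]) simp_all
    next
      case False': False
      \<comment> \<open>Now \<open>s \<ge> 2\<close>, while \<open>dim R\<close> and
        \<open>t\<close> are positive and the three sum to at most 4.\<close>
      then have "t = 1" using n r \<open>s \<noteq> 0\<close> \<open>t \<noteq> 0\<close> by linarith
      moreover obtain w where "w \<in> orthogonal C1" "w \<notin> C1" using False by blast
      ultimately show ?thesis
        using t x by (intro lagrangian_if_small_orthogonal_C1[of w x]) simp_all
    qed
  next
    case c2: False
    \<comment> \<open>\<open>dim C2 \<ge> 2\<close> forces \<open>dim R \<ge> 2\<close>, so the
      bound 4 is attained with \<open>s = t = 1\<close>.\<close>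
    then have *: "s = 1" "dim R = 2" "dim C2 = 2" using n c \<open>s \<noteq> 0\<close> \<open>t \<noteq> 0\<close> by linarith+
    then have RC2: "R = C2"
      using subspace_dim_equal[OF subspace_lower_central subspace_R C2_subset_R] by simp
    have "dim (orthogonal C2) < dim UNIV" using codim * by simp
    then have "orthogonal C2 \<noteq> UNIV" by auto
    then obtain y where "y \<notin> orthogonal C2" by blast
    then have "y \<notin> span (orthogonal C2)"
      by (simp add: span_eq_iff[THEN iffD2] subspace_orthogonal)
    then have "dim (insert y (orthogonal C2)) = dim (orthogonal C2) + 1"
      by (simp add: dim_insert)
    then obtain x where x: "span (insert x (insert y (orthogonal C2))) = UNIV"
      using codim * codim_one_complement[of "insert y (orthogonal C2)"] by auto
    obtain e where "e \<in> C1" "e \<notin> orthogonal C1"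
        "\<And>w. w \<in> orthogonal C1 \<Longrightarrow> \<omega> (bracket x w) e = 0"
      using bracket_adapted_vector_exists[OF RC2, of x] False by blast
    then show ?thesis
      using x s * by (intro lagrangian_if_small_C1[of e x y]) simp_all
  qed
qed

end

theorem theorem9p6:
  fixes scale :: "'k::field_char_0 \<Rightarrow> 'g::ab_group_add \<Rightarrow> 'g"
    and bracket :: "'g \<Rightarrow> 'g \<Rightarrow> 'g"
    and \<omega> :: "'g \<Rightarrow> 'g \<Rightarrow> 'k"
  assumes "symplectic_lie_algebra scale bracket \<omega>"
    and "lie_algebra.three_step_nilpotent scale bracket"
    and "vector_space.dim scale (UNIV :: 'g set) \<le> 8"
  shows "\<exists>\<aa>. symplectic_lie_algebra.lagrangian_ideal scale bracket \<omega> \<aa>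
           \<and> lie_algebra.lower_central scale bracket 2 \<subseteq> \<aa>"
proof -
  interpret three_step_symplectic_lie_algebra scale bracket \<omega>
    using assms(1,2)
    by (simp add: three_step_symplectic_lie_algebra_def three_step_symplectic_lie_algebra_axioms_def)
  show ?thesis
    using lagrangian_ideal_exists assms(3) by (simp only: numeral_2_eq_2)
qed

end
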